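(* Let $T:E\to F$ be a generalised triple homomorphism between two Jordan Banach triples. Let $I=\sigma_F(T)$ be the separating space of $T$ in $F$ and let $F_0$ be the norm-closed subtriple of $F$ generated by $T(E)$. Then: (a) $I$ is a (closed) triple ideal of $F_0$. (b) $I_{F_0}^{\perp}$ contains all the elements of the form $\check{T}(a,b,c)$, with $a,b,c\in E$. Further, if $J$ is a closed triple ideal of $F_0$ containing $I_{F_0}^{\perp}$, then $\pi\circ T$ is a triple homomorphism, where $\pi:F_0\to F_0/(J\cap F_0)$ is the quotient map.
   Context: A complex (resp. real) Jordan Banach triple is a complex (resp. real) Banach space $E$ with a continuous triple product $\{\cdot,\cdot,\cdot\}:E\times E\times E\to E$ that is bilinear and symmetric in the outer variables and conjugate linear (resp. linear) in the middle one, satisfying the Jordan identity $L(a,b)L(x,y)-L(x,y)L(a,b)=L(L(a,b)x,y)-L(x,L(b,a)y)$ for all $a,b,x,y$, where $L(x,y)z=\{x,y,z\}$. "Jordan Banach triple" means real or complex Jordan Banach triple. For a (not necessarily continuous) linear mapping $T:E\to F$ put $\check T(a,b,c)=T(\{a,b,c\})-\{T(a),T(b),T(c)\}$. $T$ is a triple homomorphism if $\check T=0$, and a generalised triple homomorphism if $\check T$ is jointly continuous, i.e. there is $C>0$ with $\|\check T(a,b,c)\|\le C\|a\|\|b\|\|c\|$ for all $a,b,c\in E$. The separating space $\sigma_F(T)$ is the set of all $z\in F$ for which there is a sequence $(x_n)$ in $E$ with $x_n\to0$ and $T(x_n)\to z$. A subtriple of $E$ is a linear subspace $S$ with $\{S,S,S\}\subseteq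 S$; a triple ideal of $E$ is a linear subspace $I$ with $\{E,E,I\}+\{E,I,E\}\subseteq I$. The norm-closed subtriple generated by a subset is the smallest norm-closed subtriple containing it. The quotient by a closed triple ideal is a Jordan triple in the natural way. Elements $a,b$ of a Jordan Banach triple $E$ are orthogonal, $a\perp b$, if $L(a,b)=L(b,a)=0$ on $E$. For $M\subseteq E$, $M_E^{\perp}=\{y\in E: y\perp x\ \text{for all } x\in M\}$. In particular $I_{F_0}^{\perp}$ is computed inside the Jordan Banach triple $F_0$. *)

theory Defs
  imports "HOL-Analysis.Analysis"
begin

text \<open>
  The scalar field is a type of the class below, with instances \<open>real\<close> (trivial conjugation)
  and \<open>complex\<close> (complex conjugation), so that the real and the complex theory are treated at
  once. The last axiom excludes \<open>complex\<close> with the trivial conjugation.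
\<close>

class conj_scalar = real_normed_field +
  fixes conjugate :: "'a \<Rightarrow> 'a"
  assumes conjugate_add: "conjugate (x + y) = conjugate x + conjugate y"
    and conjugate_mult: "conjugate (x * y) = conjugate x * conjugate y"
    and conjugate_conjugate: "conjugate (conjugate x) = x"
    and mult_conjugate: "x * conjugate x = (norm x)\<^sup>2 *\<^sub>R 1"

instantiation real :: conj_scalar
begin
definition "conjugate = (\<lambda>x::real. x)"
instance by standard (auto simp: conjugate_real_def power2_eq_square)
end

instantiation complex :: conj_scalar
begin
definition "conjugate = cnj"
instance
  by standard (simp_all only: conjugate_complex_def complex_cnj_add complex_cnj_mult
      complex_cnj_cnj scaleR_conv_of_real mult_1_right
      complex_norm_square[symmetric] of_real_power)
end

text \<open>
  A Banach space over \<open>'k\<close> is a type of class \<open>banach\<close> (a real Banach space) with a compatible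
  scalar multiplication \<open>s\<close> by \<open>'k\<close>; for \<open>'k = real\<close> this forces \<open>s = scaleR\<close>.
  The operator \<open>L(x,y)\<close> is the partial application \<open>p x y\<close>. Linearity in the third variable
  follows from symmetry.
\<close>

locale jordan_banach_triple = vector_space s
  for s :: "'k::conj_scalar \<Rightarrow> 'a::banach \<Rightarrow> 'a" +
  fixes p :: "'a \<Rightarrow> 'a \<Rightarrow> 'a \<Rightarrow> 'a"
  assumes scale_of_real: "s (of_real r) x = r *\<^sub>R x"
    and norm_scale: "norm (s c x) = norm c * norm x"
    and product_add_left: "p (x + x') y z = p x y z + p x' y z"
    and product_scale_left: "p (s c x) y z = s c (p x y z)"
    and product_add_mid: "p x (y + y') z = p x y z + p x y' z"
    and product_scale_mid: "p x (s c y) z = s (conjugate c) (p x y z)"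
    and product_sym: "p x y z = p z y x"
    and product_continuous: "continuous_on UNIV (\<lambda>(x, y, z). p x y z)"
    and jordan_identity:
      "p a b (p x y z) - p x y (p a b z) = p (p a b x) y z - p x (p b a y) z"

definition subtriple ::
    "('k::field \<Rightarrow> 'a::ab_group_add \<Rightarrow> 'a) \<Rightarrow> ('a \<Rightarrow> 'a \<Rightarrow> 'a \<Rightarrow> 'a) \<Rightarrow> 'a set \<Rightarrow> bool" where
  "subtriple s p S \<longleftrightarrow> module.subspace s S \<and> (\<forall>x\<in>S. \<forall>y\<in>S. \<forall>z\<in>S. p x y z \<in> S)"

definition closed_subtriple_generated ::
    "('k::field \<Rightarrow> 'a::{ab_group_add, topological_space} \<Rightarrow> 'a) \<Rightarrow> ('a \<Rightarrow> 'a \<Rightarrow> 'a \<Rightarrow> 'a)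
      \<Rightarrow> 'a set \<Rightarrow> 'a set" where
  "closed_subtriple_generated s p M = (\<lambda>S. subtriple s p S \<and> closed S) hull M"

text \<open>\<open>triple_ideal s p S I\<close>: \<open>I\<close> is a triple ideal of the subtriple \<open>S\<close>.\<close>

definition triple_ideal ::
    "('k::field \<Rightarrow> 'a::ab_group_add \<Rightarrow> 'a) \<Rightarrow> ('a \<Rightarrow> 'a \<Rightarrow> 'a \<Rightarrow> 'a) \<Rightarrow> 'a set \<Rightarrow> 'a set \<Rightarrow> bool"
  where
  "triple_ideal s p S I \<longleftrightarrow> I \<subseteq> S \<and> module.subspace s I \<and>
     (\<forall>x\<in>S. \<forall>y\<in>S. \<forall>i\<in>I. p x y i \<in> I \<and> p x i y \<in> I)"

text \<open>Orthogonality and annihilators computed inside the subtriple \<open>S\<close>.\<close>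

definition triple_orthogonal ::
    "('a::zero \<Rightarrow> 'a \<Rightarrow> 'a \<Rightarrow> 'a) \<Rightarrow> 'a set \<Rightarrow> 'a \<Rightarrow> 'a \<Rightarrow> bool" where
  "triple_orthogonal p S a b \<longleftrightarrow> (\<forall>z\<in>S. p a b z = 0 \<and> p b a z = 0)"

definition triple_annihilator ::
    "('a::zero \<Rightarrow> 'a \<Rightarrow> 'a \<Rightarrow> 'a) \<Rightarrow> 'a set \<Rightarrow> 'a set \<Rightarrow> 'a set" where
  "triple_annihilator p S M = {y\<in>S. \<forall>x\<in>M. triple_orthogonal p S y x}"

definition separating_space ::
    "('a::real_normed_vector \<Rightarrow> 'b::real_normed_vector) \<Rightarrow> 'b set" where
  "separating_space T = {z. \<exists>x. x \<longlonglongrightarrow> 0 \<and> (\<lambda>n. T (x n)) \<longlonglongrightarrow> z}"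

text \<open>\<open>triple_defect\<close> is the map written as T with a check accent.\<close>

definition triple_defect ::
    "('a \<Rightarrow> 'a \<Rightarrow> 'a \<Rightarrow> 'a) \<Rightarrow> ('b::minus \<Rightarrow> 'b \<Rightarrow> 'b \<Rightarrow> 'b) \<Rightarrow> ('a \<Rightarrow> 'b) \<Rightarrow> 'a \<Rightarrow> 'a \<Rightarrow> 'a \<Rightarrow> 'b"
  where
  "triple_defect pE pF T a b c = T (pE a b c) - pF (T a) (T b) (T c)"

definition generalised_triple_homomorphism ::
    "('k::conj_scalar \<Rightarrow> 'a::banach \<Rightarrow> 'a) \<Rightarrow> ('a \<Rightarrow> 'a \<Rightarrow> 'a \<Rightarrow> 'a) \<Rightarrow>
     ('k \<Rightarrow> 'b::banach \<Rightarrow> 'b) \<Rightarrow> ('b \<Rightarrow> 'b \<Rightarrow> 'b \<Rightarrow> 'b) \<Rightarrow> ('a \<Rightarrow> 'b) \<Rightarrow> bool" where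
  "generalised_triple_homomorphism sE pE sF pF T \<longleftrightarrow>
     Vector_Spaces.linear sE sF T \<and>
     (\<exists>C>0. \<forall>a b c. norm (triple_defect pE pF T a b c) \<le> C * norm a * norm b * norm c)"

text \<open>
  A quotient has a set of cosets as its carrier and is not a type, so homomorphisms into it are
  stated for triples given by an explicit carrier and explicit operations.
\<close>

record ('k, 'a) triple =
  tcarrier :: "'a set"
  tadd :: "'a \<Rightarrow> 'a \<Rightarrow> 'a"
  tscale :: "'k \<Rightarrow> 'a \<Rightarrow> 'a"
  tproduct :: "'a \<Rightarrow> 'a \<Rightarrow> 'a \<Rightarrow> 'a"

definition triple_on ::
    "('k \<Rightarrow> 'a::plus \<Rightarrow> 'a) \<Rightarrow> ('a \<Rightarrow> 'a \<Rightarrow> 'a \<Rightarrow> 'a) \<Rightarrow> 'a set \<Rightarrow> ('k, 'a) triple" where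
  "triple_on s p S = \<lparr>tcarrier = S, tadd = (+), tscale = s, tproduct = p\<rparr>"

text \<open>A linear map preserving the triple product, that is, with vanishing defect.\<close>

definition triple_homomorphism ::
    "('k, 'a) triple \<Rightarrow> ('k, 'b) triple \<Rightarrow> ('a \<Rightarrow> 'b) \<Rightarrow> bool" where
  "triple_homomorphism A B f \<longleftrightarrow>
     f \<in> tcarrier A \<rightarrow> tcarrier B \<and>
     (\<forall>x\<in>tcarrier A. \<forall>y\<in>tcarrier A. f (tadd A x y) = tadd B (f x) (f y)) \<and>
     (\<forall>c. \<forall>x\<in>tcarrier A. f (tscale A c x) = tscale B c (f x)) \<and>
     (\<forall>x\<in>tcarrier A. \<forall>y\<in>tcarrier A. \<forall>z\<in>tcarrier A.
        f (tproduct A x y z) = tproduct B (f x) (f y) (f z))"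

text \<open>
  \<open>triple_coset A J\<close> is the quotient map onto \<open>A / J\<close>. Operations on cosets are unions over all
  representatives; for an ideal they do not depend on the representatives
  (see the lemmas at the end).
\<close>

definition triple_coset :: "('k, 'a) triple \<Rightarrow> 'a set \<Rightarrow> 'a \<Rightarrow> 'a set" where
  "triple_coset A J x = tadd A x ` J"

definition quotient_triple :: "('k, 'a) triple \<Rightarrow> 'a set \<Rightarrow> ('k, 'a set) triple" where
  "quotient_triple A J =
     \<lparr>tcarrier = triple_coset A J ` tcarrier A,
      tadd = (\<lambda>X Y. \<Union>x\<in>X. \<Union>y\<in>Y. triple_coset A J (tadd A x y)),
      tscale = (\<lambda>c X. \<Union>x\<in>X. triple_coset A J (tscale A c x)),
      tproduct = (\<lambda>X Y Z. \<Union>x\<in>X. \<Union>y\<in>Y. \<Union>z\<in>Z. triple_coset A J (tproduct A x y z))\<rparr>"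

context jordan_banach_triple
begin

lemma triple_coset_eq_iff:
  assumes "subspace J"
  shows "triple_coset (triple_on s p S) J x = triple_coset (triple_on s p S) J y \<longleftrightarrow> x - y \<in> J"
proof
  assume eq: "triple_coset (triple_on s p S) J x = triple_coset (triple_on s p S) J y"
  have "x + 0 \<in> triple_coset (triple_on s p S) J x"
    using subspace_0[OF assms] unfolding triple_coset_def triple_on_def by auto
  then have "x \<in> (+) y ` J"
    using eq by (simp add: triple_coset_def triple_on_def)
  then show "x - y \<in> J" by auto
next
  assume d: "x - y \<in> J"
  have 1: "(+) u ` J \<subseteq> (+) v ` J" if "u - v \<in> J" for u v
  proof
    fix w assume "w \<in> (+) u ` J"
    then obtain j where j: "j \<in> J" "w = u + j" by auto
    have "(u - v) + j \<in> J" using subspace_add[OF assms that j(1)] .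
    moreover have "w = v + ((u - v) + j)" using j by simp
    ultimately show "w \<in> (+) v ` J" by blast
  qed
  have "y - x \<in> J" using subspace_neg[OF assms d] by simp
  then show "triple_coset (triple_on s p S) J x = triple_coset (triple_on s p S) J y"
    using 1 d by (simp add: triple_coset_def triple_on_def set_eq_subset)
qed

lemma quotient_triple_operations:
  assumes S: "subtriple s p S" and J: "triple_ideal s p S J"
    and x: "x \<in> S" and y: "y \<in> S" and z: "z \<in> S"
  defines "Q \<equiv> quotient_triple (triple_on s p S) J"
    and "q \<equiv> triple_coset (triple_on s p S) J"
  shows "tadd Q (q x) (q y) = q (x + y)"
    and "tscale Q c (q x) = q (s c x)"
    and "tproduct Q (q x) (q y) (q z) = q (p x y z)"
proof -
  have sJ: "subspace J" and JS: "J \<subseteq> S"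
    and ideal: "\<And>u v j. u \<in> S \<Longrightarrow> v \<in> S \<Longrightarrow> j \<in> J \<Longrightarrow> p u v j \<in> J \<and> p u j v \<in> J"
    using J by (auto simp: triple_ideal_def)
  have sS: "subspace S" using S by (simp add: subtriple_def)
  have J0: "0 \<in> J" by (rule subspace_0[OF sJ])
  have q_eq: "q u = q v" if "u - v \<in> J" for u v
    unfolding q_def using triple_coset_eq_iff[OF sJ] that by blast
  have q_set: "q u = (+) u ` J" for u
    by (simp add: q_def triple_coset_def triple_on_def)
  have ne: "J \<noteq> {}" using J0 by blast
  show "tadd Q (q x) (q y) = q (x + y)"
  proof -
    have "q ((x + i) + (y + j)) = q (x + y)" if "i \<in> J" "j \<in> J" for i j
      by (rule q_eq) (use subspace_add[OF sJ that] in \<open>simp add: algebra_simps\<close>)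
    then show ?thesis
      unfolding Q_def quotient_triple_def q_def[symmetric] 
      by (simp add: q_set[of x] q_set[of y] triple_on_def ne)
  qed
  show "tscale Q c (q x) = q (s c x)"
  proof -
    have "q (s c (x + i)) = q (s c x)" if "i \<in> J" for i
      by (rule q_eq) (use subspace_scale[OF sJ that] in \<open>simp add: scale_right_distrib\<close>)
    then show ?thesis
      unfolding Q_def quotient_triple_def q_def[symmetric] 
      by (simp add: q_set[of x] triple_on_def ne)
  qed
  show "tproduct Q (q x) (q y) (q z) = q (p x y z)"
  proof -
    have "q (p (x + i) (y + j) (z + k)) = q (p x y z)" if ijk: "i \<in> J" "j \<in> J" "k \<in> J" for i j k
    proof (rule q_eq)
      have yj: "y + j \<in> S" and zk: "z + k \<in> S"
        using subspace_add[OF sS] y z ijk JS by auto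
      have "p (x + i) (y + j) (z + k) = p x (y + j) (z + k) + p i (y + j) (z + k)"
        by (rule product_add_left)
      also have "p x (y + j) (z + k) = p x y (z + k) + p x j (z + k)"
        by (rule product_add_mid)
      also have "p x y (z + k) = p x y z + p x y k"
        using product_add_left[of z k y x] by (simp only: product_sym[of x])
      finally have "p (x + i) (y + j) (z + k) - p x y z
          = p x y k + p x j (z + k) + p i (y + j) (z + k)"
        by (simp add: algebra_simps)
      moreover have "p x y k \<in> J" "p x j (z + k) \<in> J"
        using ideal x y zk ijk by auto
      moreover have "p i (y + j) (z + k) \<in> J"
        using ideal[OF zk yj ijk(1)] by (simp only: product_sym[of i])
      ultimately show "p (x + i) (y + j) (z + k) - p x y z \<in> J"
        using subspace_add[OF sJ] by auto
    qed
    then show ?thesis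
      unfolding Q_def quotient_triple_def q_def[symmetric] 
      by (simp add: q_set[of x] q_set[of y] q_set[of z] triple_on_def ne)
  qed
qed

end

end

theory Submission
  imports Defs
begin

text \<open>
  Write \<open>D\<close> for the set of defects of \<open>T\<close>. Applying \<open>T\<close> to the Jordan identity of \<open>E\<close> expresses
  \<open>{Ta,Tb,\<close>defect\<open>(x,y,z)}\<close> through terms that are continuous in the variables of the defect.
  Letting one variable tend to \<open>0\<close> while its image tends to \<open>i \<in> I\<close> kills all products with one
  factor in each of \<open>D\<close>, \<open>I\<close> and \<open>T(E)\<close>. The common kernel of \<open>L(d,i)\<close> and \<open>L(i,d)\<close> is a closed
  subtriple, which gives (b).

  Although \<open>{T(E),T(E),I}\<close> and \<open>{T(E),I,T(E)}\<close> lie in \<open>I\<close> by continuity of the defect, (a) is not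
  immediate because \<open>F\<^sub>0\<close> may be larger than the closure of \<open>T(E)\<close>. Let \<open>B\<close> be the set of elements
  of \<open>F\<^sub>0\<close> all of whose products with one factor in \<open>I\<close> and one in \<open>T(E)\<close> vanish. It contains \<open>D\<close>
  and is stable under the products with two factors in \<open>T(E) + B\<close>, so \<open>T(E) + B\<close> is a subtriple,
  dense in \<open>F\<^sub>0\<close>, whose products with \<open>I\<close> stay in \<open>I\<close>.
\<close>

section \<open>Separating spaces\<close>

lemma separating_space_iff:
  "z \<in> separating_space T \<longleftrightarrow> (\<forall>e>0. \<exists>x. norm x < e \<and> dist (T x) z < e)"
proof
  assume "z \<in> separating_space T"
  then obtain x where x: "x \<longlonglongrightarrow> 0" "(\<lambda>n. T (x n)) \<longlonglongrightarrow> z"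
    by (auto simp: separating_space_def)
  show "\<forall>e>0. \<exists>x. norm x < e \<and> dist (T x) z < e"
  proof (intro allI impI)
    fix e :: real assume "e > 0"
    then have "\<forall>\<^sub>F n in sequentially. dist (x n) 0 < e \<and> dist (T (x n)) z < e"
      using x by (intro eventually_conj tendstoD)
    then obtain n where "dist (x n) 0 < e \<and> dist (T (x n)) z < e"
      using eventually_happens'[OF sequentially_bot] by blast
    then show "\<exists>x. norm x < e \<and> dist (T x) z < e" by auto
  qed
next
  assume approx: "\<forall>e>0. \<exists>x. norm x < e \<and> dist (T x) z < e"
  have "\<forall>n. \<exists>x. norm x < inverse (real (Suc n)) \<and> dist (T x) z < inverse (real (Suc n))"
    using approx by simp
  then obtain x where x: "\<And>n. norm (x n) < inverse (real (Suc n))"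
      "\<And>n. dist (T (x n)) z < inverse (real (Suc n))"
    by metis
  have "x \<longlonglongrightarrow> 0"
    by (rule Lim_null_comparison[OF _ LIMSEQ_inverse_real_of_nat])
      (use x(1) in \<open>auto intro: always_eventually less_imp_le\<close>)
  moreover have "(\<lambda>n. T (x n)) \<longlonglongrightarrow> z"
    by (rule LIM_zero_cancel, rule Lim_null_comparison[OF _ LIMSEQ_inverse_real_of_nat])
      (use x(2) in \<open>auto simp: dist_norm intro: always_eventually less_imp_le\<close>)
  ultimately show "z \<in> separating_space T"
    by (auto simp: separating_space_def)
qed

text \<open>The epsilon form avoids a diagonal sequence: for \<open>w\<close> in the separating
  space close to \<open>z\<close>, a vector that serves \<open>w\<close> at \<open>e / 2\<close>
  serves \<open>z\<close> at \<open>e\<close>.\<close>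

lemma closed_separating_space: "closed (separating_space T)"
proof -
  have "z \<in> separating_space T" if z: "z \<in> closure (separating_space T)" for z
    unfolding separating_space_iff
  proof (intro allI impI)
    fix e :: real assume e: "e > 0"
    then obtain w where w: "w \<in> separating_space T" "dist w z < e / 2"
      using z unfolding closure_approachable by (meson half_gt_zero)
    obtain x where x: "norm x < e / 2" "dist (T x) w < e / 2"
      using w(1) e unfolding separating_space_iff by (meson half_gt_zero)
    have "dist (T x) z < e"
      using x(2) w(2) dist_triangle[of "T x" z w] by simp
    then show "\<exists>x. norm x < e \<and> dist (T x) z < e"
      using x(1) e by (intro exI[of _ x]) auto
  qed
  then show ?thesis
    by (metis closure_closed closure_subset closed_closure subsetI subset_antisym)
qed

section \<open>Continuity and closed subtriples in a Jordan Banach triple\<close>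

context jordan_banach_triple
begin

lemma product_add_right: "p x y (z + z') = p x y z + p x y z'"
  using product_add_left[of z z' y x] by (simp only: product_sym[of x])

lemma product_scale_right: "p x y (s c z) = s c (p x y z)"
  using product_scale_left[of c z y x] by (simp only: product_sym[of x])

lemma product_zero [simp]: "p 0 y z = 0" "p x 0 z = 0" "p x y 0 = 0"
  using product_add_left[of 0 0] product_add_mid[of _ 0 0] product_add_right[of _ _ 0 0] by simp_all

lemma tendsto_product:
  assumes "(f \<longlongrightarrow> x) F" "(g \<longlongrightarrow> y) F" "(h \<longlongrightarrow> z) F"
  shows "((\<lambda>n. p (f n) (g n) (h n)) \<longlongrightarrow> p x y z) F"
proof -
  have "isCont (\<lambda>(x, y, z). p x y z) (x, y, z)"
    using product_continuous by (simp add: continuous_on_eq_continuous_at)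
  from isCont_tendsto_compose[OF this tendsto_Pair[OF assms(1) tendsto_Pair[OF assms(2,3)]]]
  show ?thesis by simp
qed

lemma tendsto_scale:
  assumes "(f \<longlongrightarrow> x) F"
  shows "((\<lambda>n. s c (f n)) \<longlongrightarrow> s c x) F"
proof -
  have "((\<lambda>n. norm c * norm (f n - x)) \<longlongrightarrow> 0) F"
    using assms by (auto intro!: tendsto_eq_intros simp: LIM_zero_iff)
  then have "((\<lambda>n. s c (f n) - s c x) \<longlongrightarrow> 0) F"
    by (rule Lim_null_comparison[rotated]) (simp flip: norm_scale scale_right_diff_distrib)
  then show ?thesis by (simp add: LIM_zero_iff)
qed

text \<open>The three sets are independent so that the lemma covers both closures of subtriples and
  ideal inclusions, where one factor runs through a different set.\<close>

lemma product_closure: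
  assumes "\<And>x y z. x \<in> A \<Longrightarrow> y \<in> B \<Longrightarrow> z \<in> C \<Longrightarrow> p x y z \<in> W" "closed W"
    and "x \<in> closure A" "y \<in> closure B" "z \<in> closure C"
  shows "p x y z \<in> W"
proof -
  obtain f g h where "\<And>n. f n \<in> A" "f \<longlonglongrightarrow> x" "\<And>n. g n \<in> B" "g \<longlonglongrightarrow> y" "\<And>n. h n \<in> C" "h \<longlonglongrightarrow> z"
    using assms(3-5) by (auto simp: closure_sequential)
  then show ?thesis
    using closed_sequentially[OF assms(2), of "\<lambda>n. p (f n) (g n) (h n)"]
      tendsto_product assms(1) by blast
qed

lemma subspace_closure:
  assumes G: "subspace G"
  shows "subspace (closure G)"
  unfolding subspace_def
proof (intro conjI ballI allI)
  show "0 \<in> closure G" using subspace_0[OF G] closure_subset by blast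
next
  fix x y assume "x \<in> closure G" "y \<in> closure G"
  then obtain f g where "\<And>n. f n \<in> G" "f \<longlonglongrightarrow> x" "\<And>n. g n \<in> G" "g \<longlonglongrightarrow> y"
    by (auto simp: closure_sequential)
  then show "x + y \<in> closure G"
    unfolding closure_sequential using subspace_add[OF G] tendsto_add
    by (intro exI[of _ "\<lambda>n. f n + g n"]) blast
next
  fix c x assume "x \<in> closure G"
  then obtain f where "\<And>n. f n \<in> G" "f \<longlonglongrightarrow> x"
    by (auto simp: closure_sequential)
  then show "s c x \<in> closure G"
    unfolding closure_sequential using subspace_scale[OF G] tendsto_scale
    by (intro exI[of _ "\<lambda>n. s c (f n)"]) blast
qed

lemma subtriple_closure:
  assumes "subtriple s p G"
  shows "subtriple s p (closure G)"
proof -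
  have "p x y z \<in> closure G" if "x \<in> closure G" "y \<in> closure G" "z \<in> closure G" for x y z
    by (rule product_closure[OF _ closed_closure that])
      (use assms closure_subset[of G] in \<open>auto simp: subtriple_def\<close>)
  then show ?thesis
    using assms subspace_closure by (simp add: subtriple_def)
qed

text \<open>By the Jordan identity \<open>p u v\<close> acts on \<open>p x y z\<close> like a
  derivation, up to a sign and with \<open>p v u\<close> acting on the middle factor. Hence both
  operators are required to vanish together.\<close>

lemma closed_subtriple_kernel:
  "subtriple s p {z. p u v z = 0 \<and> p v u z = 0}" (is "subtriple s p ?K")
  "closed {z. p u v z = 0 \<and> p v u z = 0}"
proof -
  have "p u v (p x y z) = 0"
    if "p u v x = 0" "p v u y = 0" "p u v z = 0" for u v x y z
    using jordan_identity[of u v x y z] that by simp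
  then have "p x y z \<in> ?K" if "x \<in> ?K" "y \<in> ?K" "z \<in> ?K" for x y z
    using that by simp
  moreover have "subspace ?K"
    by (auto simp: subspace_def product_add_right product_scale_right)
  ultimately show "subtriple s p ?K"
    unfolding subtriple_def by blast
  have "continuous_on UNIV (p u v)" for u v
    unfolding continuous_on_def by (intro ballI tendsto_product tendsto_const tendsto_ident_at)
  then show "closed ?K"
    by (intro closed_Collect_conj closed_Collect_eq continuous_on_const) auto
qed

lemma closed_subtriple_generated_least:
  assumes "M \<subseteq> S" "subtriple s p S" "closed S"
  shows "closed_subtriple_generated s p M \<subseteq> S"
  unfolding closed_subtriple_generated_def by (rule hull_minimal) (use assms in auto)

lemma closed_subtriple_generated:
  "M \<subseteq> closed_subtriple_generated s p M"
  "subtriple s p (closed_subtriple_generated s p M)"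
  "closed (closed_subtriple_generated s p M)"
proof -
  show "M \<subseteq> closed_subtriple_generated s p M"
    unfolding closed_subtriple_generated_def by (rule hull_subset)
  let ?P = "\<lambda>S. subtriple s p S \<and> closed S"
  have "?P (\<Inter>\<S>)" if P: "Ball \<S> ?P" for \<S>
  proof
    show "subtriple s p (\<Inter>\<S>)"
      using P by (simp add: subtriple_def subspace_def)
    show "closed (\<Inter>\<S>)"
      using P by (simp add: closed_Inter)
  qed
  then have "?P (?P hull M)" by (rule hull_in[of ?P])
  then show "subtriple s p (closed_subtriple_generated s p M)"
      "closed (closed_subtriple_generated s p M)"
    by (simp_all add: closed_subtriple_generated_def)
qed

section \<open>Stability of the strong annihilator under products\<close>

definition strong_annihilator :: "'a set \<Rightarrow> 'a set \<Rightarrow> 'a set" where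
  "strong_annihilator X I =
     {y. \<forall>x\<in>X. \<forall>i\<in>I. p y i x = 0 \<and> p i y x = 0 \<and> p y x i = 0}"

lemma subspace_strong_annihilator: "subspace (strong_annihilator X I)"
  by (auto simp: subspace_def strong_annihilator_def product_add_left product_add_mid
      product_scale_left product_scale_mid)

context
  fixes X I :: "'a set"
  assumes ideal: "\<And>a b i. a \<in> X \<Longrightarrow> b \<in> X \<Longrightarrow> i \<in> I \<Longrightarrow> p a b i \<in> I"
    and ideal_mid: "\<And>a b i. a \<in> X \<Longrightarrow> b \<in> X \<Longrightarrow> i \<in> I \<Longrightarrow> p a i b \<in> I"
begin

text \<open>Outer symmetry extends the three defining equations to all six orders of the
  factors.\<close>

lemma strong_annihilator_zero:
  assumes "y \<in> strong_annihilator X I" "x \<in> X" "i \<in> I"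
  shows "p y i x = 0" "p x i y = 0" "p i y x = 0" "p x y i = 0" "p y x i = 0" "p i x y = 0"
  using assms product_sym[of x i y] product_sym[of x y i] product_sym[of i x y]
  by (simp_all add: strong_annihilator_def)

text \<open>\<open>X\<close> need not be a subtriple: the lemma will help to show that
  \<open>dense_subtriple\<close> is one. As \<open>p a b c\<close> may leave \<open>X\<close>, the
  Jordan identity first spreads \<open>p y i\<close> over its factors, and then moves the product
  with \<open>a\<close> and \<open>b\<close> from \<open>y\<close> to \<open>i\<close>, which stays
  in \<open>I\<close>.\<close>

lemma product_strong_annihilator:
  assumes a: "a \<in> X" and b: "b \<in> X" and y: "y \<in> strong_annihilator X I"
  shows "p a b y \<in> strong_annihilator X I"
  unfolding strong_annihilator_def
proof (intro CollectI ballI conjI)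
  fix c i assume c: "c \<in> X" and i: "i \<in> I"
  note z = strong_annihilator_zero[OF y]
  have ii: "p b a i \<in> I" "p i c a \<in> I" "p c i b \<in> I"
    using ideal[OF b a i] ideal[OF a c i] ideal_mid[OF c b i] by (auto simp: product_sym[of i])
  have "p y i (p a b c) = 0"
    using jordan_identity[of y i a b c] z[OF _ i] a b c by simp
  then show "p (p a b y) i c = 0"
    using jordan_identity[of a b y i c] z(1)[OF c ii(1)] z(1)[OF c i] by simp
  have "p i y (p b a c) = 0"
    using jordan_identity[of i y b a c] z[OF _ i] a b c by simp
  then show "p i (p a b y) c = 0"
    using jordan_identity[of b a i y c] z(3)[OF c ii(1)] z(3)[OF c i] by simp
  \<comment> \<open>Each term of the expansion pairs \<open>y\<close> with an element of
    \<open>I\<close>: \<open>i\<close>, \<open>p i c a\<close> or \<open>p c i b\<close>.\<close>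
  have "p i c (p y b a) = 0"
    using jordan_identity[of i c y b a] z(6)[OF c i] z(1)[OF a ii(3)] z(5)[OF b ii(2)] by simp
  then show "p (p a b y) c i = 0"
    by (simp only: product_sym[of "p y b a" c] product_sym[of a b y])
qed

lemma product_mid_strong_annihilator:
  assumes a: "a \<in> X" and b: "b \<in> X" and y: "y \<in> strong_annihilator X I"
  shows "p a y b \<in> strong_annihilator X I"
  unfolding strong_annihilator_def
proof (intro CollectI ballI conjI)
  fix c i assume c: "c \<in> X" and i: "i \<in> I"
  note z = strong_annihilator_zero[OF y]
  have ii: "p i c a \<in> I" "p i c b \<in> I" "p i b c \<in> I"
    using ideal[OF c b i] ideal[OF b c i] ideal[OF a c i]
    by (auto simp: product_sym[of i])
  text \<open>
    The form \<open>p (p a y b) i c\<close> in \<open>a\<close>, \<open>b\<close>, \<open>c\<close> is symmetric in \<open>a\<close>, \<open>b\<close> and alternating in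
    \<open>b\<close>, \<open>c\<close>, so it vanishes.
  \<close>
  have alt: "p (p u y v) i w = - p (p u y w) i v" if "u \<in> X" "v \<in> X" "w \<in> X" for u v w
  proof -
    \<comment> \<open>\<open>p v i w\<close> is again in \<open>I\<close>, and
      \<open>p y u i\<close> vanishes by the third defining equation, so only two terms of the
      Jordan identity survive.\<close>
    have "p u y (p v i w) = 0"
      using z(4)[OF that(1) ideal_mid[OF that(2,3) i]] .
    then show ?thesis
      using jordan_identity[of u y v i w] z(5)[OF that(1) i]
      by (simp add: product_sym[of v i])
  qed
  have sym: "p (p u y v) i w = p (p v y u) i w" for u v w
    by (simp only: product_sym[of u])
  \<comment> \<open>Using \<open>alt\<close> and \<open>sym\<close> in turn runs through all six
    orders of \<open>a\<close>, \<open>b\<close>, \<open>c\<close> and returns with three sign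
    changes.\<close>
  have "p (p a y b) i c = - p (p a y b) i c"
    using alt[OF a b c] alt[OF c a b] alt[OF b c a] sym[of a b c] sym[of b c a] sym[of c a b]
    by simp
  then have "2 *\<^sub>R p (p a y b) i c = 0"
    by (metis add.right_inverse scaleR_2)
  then show "p (p a y b) i c = 0" by simp
  \<comment> \<open>The outer product \<open>p c a y\<close> is already known to be in the
    annihilator; expanding \<open>p y a (p i b c)\<close> transfers this to \<open>p a y b\<close>
    in the middle.\<close>
  have "p i b (p c a y) = 0"
    using strong_annihilator_zero(6)[OF product_strong_annihilator[OF c a y] b i] .
  then show "p i (p a y b) c = 0"
    using jordan_identity[of y a i b c] z(5)[OF a i] z(5)[OF a ii(3)]
    by (simp add: product_sym[of y a c])
  have "p i c (p a y b) = 0"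
    using jordan_identity[of i c a y b] z(3)[OF b ii(1)] z(2)[OF c i] z(4)[OF a ii(2)] by simp
  then show "p (p a y b) c i = 0"
    by (simp only: product_sym[of "p a y b" c])
qed

end

end

section \<open>Defects and the separating space\<close>

locale generalised_triple_hom =
  E: jordan_banach_triple sE pE + F: jordan_banach_triple sF pF
  for sE :: "'k::conj_scalar \<Rightarrow> 'a::banach \<Rightarrow> 'a" and pE
    and sF :: "'k \<Rightarrow> 'b::banach \<Rightarrow> 'b" and pF +
  fixes T :: "'a \<Rightarrow> 'b"
  assumes hom: "generalised_triple_homomorphism sE pE sF pF T"
begin

abbreviation "defect \<equiv> triple_defect pE pF T"

abbreviation "I \<equiv> separating_space T"

abbreviation "F0 \<equiv> closed_subtriple_generated sF pF (range T)"

sublocale T: Vector_Spaces.linear sE sF T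
  using hom by (simp add: generalised_triple_homomorphism_def)

lemma T_product: "T (pE a b c) = pF (T a) (T b) (T c) + defect a b c"
  by (simp add: triple_defect_def)

text \<open>The norm bound suffices because one limit is 0 and the other two sequences converge;
  \<open>T\<close> itself may be discontinuous.\<close>

lemma tendsto_defect:
  assumes "(f \<longlongrightarrow> a) F" "(g \<longlongrightarrow> b) F" "(h \<longlongrightarrow> c) F" and "a = 0 \<or> b = 0 \<or> c = 0"
  shows "((\<lambda>n. defect (f n) (g n) (h n)) \<longlongrightarrow> 0) F"
proof -
  obtain C where C: "\<And>a b c. norm (defect a b c) \<le> C * norm a * norm b * norm c"
    using hom by (auto simp: generalised_triple_homomorphism_def)
  have "((\<lambda>n. C * norm (f n) * norm (g n) * norm (h n)) \<longlongrightarrow> C * norm a * norm b * norm c) F"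
    by (intro tendsto_intros assms)
  then have "((\<lambda>n. C * norm (f n) * norm (g n) * norm (h n)) \<longlongrightarrow> 0) F"
    using assms(4) by auto
  then show ?thesis
    by (rule Lim_null_comparison[rotated]) (simp add: C)
qed

text \<open>This compares \<open>T\<close> of the Jordan identity of E with the Jordan identity at
  the images. Every defect on the right has an argument containing \<open>a\<close> or
  \<open>b\<close>, so all of them vanish in the limit when \<open>a\<close> or \<open>b\<close>
  tends to 0.\<close>

lemma jordan_defect:
  "pF (T a) (T b) (defect x y z) + defect a b (pE x y z) =
     pF (defect a b x) (T y) (T z) + defect (pE a b x) y z
     - pF (T x) (defect b a y) (T z) - defect x (pE b a y) z
     + pF (T x) (T y) (defect a b z) + defect x y (pE a b z)"
proof -
  have "T (pE a b (pE x y z)) - T (pE x y (pE a b z)) =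
      T (pE (pE a b x) y z) - T (pE x (pE b a y) z)"
    using E.jordan_identity[of a b x y z] by (simp only: T.diff[symmetric])
  moreover have "pF (T a) (T b) (pF (T x) (T y) (T z)) =
      pF (pF (T a) (T b) (T x)) (T y) (T z) - pF (T x) (pF (T b) (T a) (T y)) (T z)
      + pF (T x) (T y) (pF (T a) (T b) (T z))"
    using F.jordan_identity[of "T a" "T b" "T x" "T y" "T z"] by (simp add: diff_eq_eq)
  ultimately show ?thesis
    by (simp add: T_product F.product_add_left F.product_add_mid F.product_add_right
        algebra_simps)
qed

lemma separating_space_defect_zero:
  assumes i: "i \<in> I"
  shows "pF i (T b) (defect x y z) = 0" "pF (T b) i (defect x y z) = 0"
    "pF i (defect x y z) (T b) = 0"
proof -
  obtain f where f: "f \<longlonglongrightarrow> 0" "(\<lambda>n. T (f n)) \<longlonglongrightarrow> i"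
    using i by (auto simp: separating_space_def)
  have p: "(\<lambda>n. pE (f n) b c) \<longlonglongrightarrow> 0" "(\<lambda>n. pE b (f n) c) \<longlonglongrightarrow> 0" "(\<lambda>n. pE b c (f n)) \<longlonglongrightarrow> 0"
    for b c
    using E.tendsto_product[OF f(1) tendsto_const tendsto_const, of b c]
      E.tendsto_product[OF tendsto_const f(1) tendsto_const, of b c]
      E.tendsto_product[OF tendsto_const tendsto_const f(1), of b c] by simp_all
  have d: "(\<lambda>n. defect (u n) b c) \<longlonglongrightarrow> 0" "(\<lambda>n. defect b (u n) c) \<longlonglongrightarrow> 0"
      "(\<lambda>n. defect b c (u n)) \<longlonglongrightarrow> 0" if "u \<longlonglongrightarrow> 0" for u b c
    using tendsto_defect[OF that tendsto_const tendsto_const]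
      tendsto_defect[OF tendsto_const that tendsto_const]
      tendsto_defect[OF tendsto_const tendsto_const that] by simp_all
  note lim = tendsto_add tendsto_diff F.tendsto_product d p f tendsto_const
  show left: "pF i (T b) (defect x y z) = 0" for b x y z
  proof -
    have "(\<lambda>n. pF (T (f n)) (T b) (defect x y z) + defect (f n) b (pE x y z))
        \<longlonglongrightarrow> pF i (T b) (defect x y z) + 0"
      by (intro lim)
    moreover have "(\<lambda>n. pF (T (f n)) (T b) (defect x y z) + defect (f n) b (pE x y z))
        \<longlonglongrightarrow> pF 0 (T y) (T z) + 0 - pF (T x) 0 (T z) - 0 + pF (T x) (T y) 0 + 0"
      unfolding jordan_defect by (intro lim)
    ultimately show ?thesis using LIMSEQ_unique by fastforce
  qed
  show "pF (T b) i (defect x y z) = 0"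
  proof -
    have "(\<lambda>n. pF (T b) (T (f n)) (defect x y z) + defect b (f n) (pE x y z))
        \<longlonglongrightarrow> pF (T b) i (defect x y z) + 0"
      by (intro lim)
    moreover have "(\<lambda>n. pF (T b) (T (f n)) (defect x y z) + defect b (f n) (pE x y z))
        \<longlonglongrightarrow> pF 0 (T y) (T z) + 0 - pF (T x) 0 (T z) - 0 + pF (T x) (T y) 0 + 0"
      unfolding jordan_defect by (intro lim)
    ultimately show ?thesis using LIMSEQ_unique by fastforce
  qed
  \<comment> \<open>Now the null sequence replaces the first entry of the inner product, which puts
    \<open>defect x y z\<close> in a middle position. The other surviving term,
    \<open>pF i (T z) (defect y x b)\<close>, is 0 by \<open>left\<close>.\<close>
  show "pF i (defect x y z) (T b) = 0"
  proof -
    have "(\<lambda>n. pF (T y) (T x) (defect (f n) z b) + defect y x (pE (f n) z b))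
        \<longlonglongrightarrow> pF (T y) (T x) 0 + 0"
      by (intro lim)
    moreover have "(\<lambda>n. pF (T y) (T x) (defect (f n) z b) + defect y x (pE (f n) z b))
        \<longlonglongrightarrow> pF 0 (T z) (T b) + 0 - pF i (defect x y z) (T b) - 0 + pF i (T z) (defect y x b) + 0"
      unfolding jordan_defect by (intro lim)
    ultimately show ?thesis using LIMSEQ_unique left by fastforce
  qed
qed

lemma subspace_separating_space: "F.subspace I"
  unfolding F.subspace_def
proof (intro conjI ballI allI)
  show "0 \<in> I"
    unfolding separating_space_def by (auto intro!: exI[of _ "\<lambda>_. 0"])
next
  fix x y assume "x \<in> I" "y \<in> I"
  then obtain f g where "f \<longlonglongrightarrow> 0" "(\<lambda>n. T (f n)) \<longlonglongrightarrow> x" "g \<longlonglongrightarrow> 0" "(\<lambda>n. T (g n)) \<longlonglongrightarrow> y"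
    by (auto simp: separating_space_def)
  then have "(\<lambda>n. f n + g n) \<longlonglongrightarrow> 0" "(\<lambda>n. T (f n + g n)) \<longlonglongrightarrow> x + y"
    by (auto intro!: tendsto_eq_intros simp: T.add)
  then show "x + y \<in> I" unfolding separating_space_def by blast
next
  fix c x assume "x \<in> I"
  then obtain f where "f \<longlonglongrightarrow> 0" "(\<lambda>n. T (f n)) \<longlonglongrightarrow> x"
    by (auto simp: separating_space_def)
  then have "(\<lambda>n. sE c (f n)) \<longlonglongrightarrow> sE c 0" "(\<lambda>n. T (sE c (f n))) \<longlonglongrightarrow> sF c x"
    unfolding T.scale by (auto dest: E.tendsto_scale F.tendsto_scale simp del: E.scale_zero_right)
  then show "sF c x \<in> I" unfolding separating_space_def by auto
qed

lemma separating_space_ideal_range: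
  assumes i: "i \<in> I"
  shows "pF (T a) (T b) i \<in> I" "pF (T a) i (T b) \<in> I"
proof -
  obtain f where f: "f \<longlonglongrightarrow> 0" "(\<lambda>n. T (f n)) \<longlonglongrightarrow> i"
    using i by (auto simp: separating_space_def)
  have "(\<lambda>n. T (pE a b (f n))) \<longlonglongrightarrow> pF (T a) (T b) i + 0"
    unfolding T_product using f
    by (intro tendsto_add F.tendsto_product tendsto_defect[where a = a and b = b and c = 0]) auto
  moreover have "(\<lambda>n. pE a b (f n)) \<longlonglongrightarrow> pE a b 0"
    using f by (intro E.tendsto_product) auto
  ultimately show "pF (T a) (T b) i \<in> I"
    unfolding separating_space_def by auto
  have "(\<lambda>n. T (pE a (f n) b)) \<longlonglongrightarrow> pF (T a) i (T b) + 0"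
    unfolding T_product using f
    by (intro tendsto_add F.tendsto_product tendsto_defect[where a = a and b = 0 and c = b]) auto
  moreover have "(\<lambda>n. pE a (f n) b) \<longlonglongrightarrow> pE a 0 b"
    using f by (intro E.tendsto_product) auto
  ultimately show "pF (T a) i (T b) \<in> I"
    unfolding separating_space_def by auto
qed

section \<open>From T(E) to \<open>F0\<close>: the annihilator contains the defects\<close>

lemmas F0_subtriple = F.closed_subtriple_generated(2)[of "range T"]

lemma range_in_F0: "T a \<in> F0"
  using F.closed_subtriple_generated(1)[of "range T"] by blast

lemma subspace_F0: "F.subspace F0"
  using F0_subtriple by (simp add: subtriple_def)

lemma product_in_F0: "x \<in> F0 \<Longrightarrow> y \<in> F0 \<Longrightarrow> z \<in> F0 \<Longrightarrow> pF x y z \<in> F0"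
  using F0_subtriple by (simp add: subtriple_def)

lemma separating_space_in_F0: "I \<subseteq> F0"
  unfolding separating_space_def
  by (auto intro: closed_sequentially[OF F.closed_subtriple_generated(3)] range_in_F0)

lemma defect_in_F0: "defect a b c \<in> F0"
  unfolding triple_defect_def
  by (intro F.subspace_diff[OF subspace_F0] product_in_F0 range_in_F0)

text \<open>The common kernel is a closed subtriple containing T(E), hence contains
  \<open>F0\<close>, even if T(E) is not dense there.\<close>

lemma orthogonal_on_F0:
  assumes "\<And>a. pF u v (T a) = 0" "\<And>a. pF v u (T a) = 0" "z \<in> F0"
  shows "pF u v z = 0" "pF v u z = 0"
  using F.closed_subtriple_generated_least[of "range T" "{z. pF u v z = 0 \<and> pF v u z = 0}"]
    F.closed_subtriple_kernel[of u v] assms by auto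

lemma defect_in_strong_annihilator: "defect a b c \<in> F.strong_annihilator (range T) I"
  unfolding F.strong_annihilator_def
  by (auto simp: separating_space_defect_zero F.product_sym[of "defect a b c"])

lemma defect_in_triple_annihilator: "defect a b c \<in> triple_annihilator pF F0 I"
  unfolding triple_annihilator_def triple_orthogonal_def
  using defect_in_strong_annihilator[of a b c] defect_in_F0 orthogonal_on_F0
  unfolding F.strong_annihilator_def by blast

section \<open>The subtriple T(E) + B\<close>

definition dense_subtriple :: "'b set" where
  "dense_subtriple = {x + y | x y. x \<in> range T \<and> y \<in> F.strong_annihilator (range T) I \<inter> F0}"

lemma dense_subtripleE:
  assumes "g \<in> dense_subtriple"
  obtains a y where "g = T a + y" "y \<in> F.strong_annihilator (range T) I" "y \<in> F0"
  using assms unfolding dense_subtriple_def by blast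

lemma dense_subtripleI:
  "y \<in> F.strong_annihilator (range T) I \<Longrightarrow> y \<in> F0 \<Longrightarrow> T a + y \<in> dense_subtriple"
  unfolding dense_subtriple_def by blast

text \<open>Only two of the three equations are extended: they concern kernels of
  \<open>pF y i\<close> and \<open>pF i y\<close>, whereas the third has its variable in the
  middle.\<close>

lemma strong_annihilator_F0:
  assumes "y \<in> F.strong_annihilator (range T) I" "i \<in> I" "z \<in> F0"
  shows "pF y i z = 0" "pF i y z = 0"
  using orthogonal_on_F0[of y i z] assms by (auto simp: F.strong_annihilator_def)

text \<open>For the third equation the roles are exchanged: \<open>w\<close> is an annihilator
  element too, so \<open>pF y w i\<close> vanishes as a product of \<open>w\<close> and
  \<open>i\<close> with the element \<open>y\<close> of \<open>F0\<close>.\<close>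

lemma strong_annihilator_dense_subtriple:
  "F.strong_annihilator (range T) I \<inter> F0 \<subseteq> F.strong_annihilator dense_subtriple I"
proof
  fix y assume "y \<in> F.strong_annihilator (range T) I \<inter> F0"
  then have y: "y \<in> F.strong_annihilator (range T) I" "y \<in> F0" by auto
  show "y \<in> F.strong_annihilator dense_subtriple I"
    unfolding F.strong_annihilator_def
  proof (intro CollectI ballI)
    fix g i assume "g \<in> dense_subtriple" and i: "i \<in> I"
    then obtain a w where g: "g = T a + w" and
        w: "w \<in> F.strong_annihilator (range T) I" "w \<in> F0"
      by (elim dense_subtripleE)
    have "pF y w i = 0"
      using strong_annihilator_F0(2)[OF w(1) i y(2)] by (simp only: F.product_sym[of y])
    moreover have "pF y (T a) i = 0"
      using y(1) i by (auto simp: F.strong_annihilator_def)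
    moreover have "g \<in> F0"
      unfolding g using F.subspace_add[OF subspace_F0 range_in_F0 w(2)] .
    ultimately show "pF y i g = 0 \<and> pF i y g = 0 \<and> pF y g i = 0"
      using strong_annihilator_F0[OF y(1) i] by (simp add: g F.product_add_mid)
  qed
qed

text \<open>All contributions of the annihilator parts vanish, leaving products of \<open>i\<close>
  with T(E). This also makes the stability lemmas available for
  \<open>X = dense_subtriple\<close>.\<close>

lemma dense_subtriple_ideal:
  assumes g: "g \<in> dense_subtriple" and h: "h \<in> dense_subtriple" and i: "i \<in> I"
  shows "pF g h i \<in> I" "pF g i h \<in> I"
proof -
  obtain a y where gy: "g = T a + y" and
      y: "y \<in> F.strong_annihilator (range T) I" "y \<in> F0"
    using g by (elim dense_subtripleE)
  obtain b w where hw: "h = T b + w" and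
      w: "w \<in> F.strong_annihilator (range T) I" "w \<in> F0"
    using h by (elim dense_subtripleE)
  have hF: "h \<in> F0"
    unfolding hw using F.subspace_add[OF subspace_F0 range_in_F0 w(2)] .
  have "pF y h i = 0"
    using strong_annihilator_dense_subtriple y h i by (auto simp: F.strong_annihilator_def)
  moreover have "pF (T a) w i = 0"
    using strong_annihilator_F0(2)[OF w(1) i range_in_F0] by (simp only: F.product_sym[of _ w])
  ultimately have "pF g h i = pF (T a) (T b) i"
    by (simp add: gy F.product_add_left) (simp add: hw F.product_add_mid)
  then show "pF g h i \<in> I" using separating_space_ideal_range(1)[OF i] by simp
  have "pF (T a) i w = 0"
    using strong_annihilator_F0(1)[OF w(1) i range_in_F0] by (simp only: F.product_sym[of _ i w])
  then have "pF g i h = pF (T a) i (T b)"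
    using strong_annihilator_F0(1)[OF y(1) i hF]
    by (simp add: gy F.product_add_left) (simp add: hw F.product_add_right)
  then show "pF g i h \<in> I" using separating_space_ideal_range(2)[OF i] by simp
qed

lemma range_in_dense_subtriple: "T a \<in> dense_subtriple"
  using dense_subtripleI[of 0 a] F.subspace_0[OF F.subspace_strong_annihilator]
    F.subspace_0[OF subspace_F0] by simp

text \<open>T(E) fails to be a subtriple only by defects, and the summand \<open>?B\<close> absorbs
  these.\<close>

lemma subtriple_dense_subtriple: "subtriple sF pF dense_subtriple"
proof -
  let ?B = "F.strong_annihilator (range T) I \<inter> F0"
  have sB: "F.subspace ?B"
    by (intro F.subspace_inter F.subspace_strong_annihilator subspace_F0)
  have range: "F.subspace (range T)"
    using T.subspace_image[OF E.subspace_UNIV] .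
  have sub: "F.subspace dense_subtriple"
    unfolding dense_subtriple_def using F.subspace_sums[OF range sB] .
  have GF: "dense_subtriple \<subseteq> F0"
    using F.subspace_add[OF subspace_F0 range_in_F0] by (auto elim: dense_subtripleE)
  have anti: "F.strong_annihilator dense_subtriple I \<subseteq> F.strong_annihilator (range T) I"
    using range_in_dense_subtriple by (auto simp: F.strong_annihilator_def)
  have BG: "?B \<subseteq> dense_subtriple"
    using dense_subtripleI[of _ 0] by auto
  \<comment> \<open>The annihilators relative to T(E) and to \<open>dense_subtriple\<close> agree
    within \<open>F0\<close>, so stability for the latter gives stability of
    \<open>?B\<close>.\<close>
  have B1: "pF g h y \<in> ?B" and B2: "pF g y h \<in> ?B"
    if "g \<in> dense_subtriple" "h \<in> dense_subtriple" "y \<in> ?B" for g h y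
  proof -
    have y: "y \<in> F.strong_annihilator dense_subtriple I"
      using strong_annihilator_dense_subtriple that(3) by (rule subsetD)
    have in_F0: "pF g h y \<in> F0" "pF g y h \<in> F0"
      using that GF by (auto intro!: product_in_F0)
    have "pF g h y \<in> F.strong_annihilator dense_subtriple I"
      by (rule F.product_strong_annihilator[OF dense_subtriple_ideal that(1,2) y])
    then show "pF g h y \<in> ?B" using anti in_F0 by auto
    have "pF g y h \<in> F.strong_annihilator dense_subtriple I"
      by (rule F.product_mid_strong_annihilator[OF dense_subtriple_ideal that(1,2) y])
    then show "pF g y h \<in> ?B" using anti in_F0 by auto
  qed
  have "pF g h k \<in> dense_subtriple"
    if ghk: "g \<in> dense_subtriple" "h \<in> dense_subtriple" "k \<in> dense_subtriple" for g h k
  proof -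
    obtain a x where g: "g = T a + x" and x: "x \<in> ?B"
      using ghk(1) by (blast elim: dense_subtripleE)
    obtain b y where h: "h = T b + y" and y: "y \<in> ?B"
      using ghk(2) by (blast elim: dense_subtripleE)
    obtain c z where k: "k = T c + z" and z: "z \<in> ?B"
      using ghk(3) by (blast elim: dense_subtripleE)
    \<comment> \<open>Splitting one factor at a time leaves, apart from the product of images, terms
      with a marked factor in \<open>?B\<close> and both others in
      \<open>dense_subtriple\<close>.\<close>
    have "pF g h k = pF (T a) (T b) (T c) + pF (T a) y (T c) + pF x h (T c) + pF g h z"
      by (simp add: k F.product_add_right)
        (simp add: g h F.product_add_left F.product_add_mid algebra_simps)
    moreover have "pF (T a) (T b) (T c) = T (pE a b c) - defect a b c"
      by (simp add: triple_defect_def)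
    ultimately have eq: "pF g h k =
        T (pE a b c) - defect a b c + pF (T a) y (T c) + pF x h (T c) + pF g h z" by simp
    have "defect a b c \<in> ?B"
      using defect_in_strong_annihilator defect_in_F0 by blast
    moreover have "pF x h (T c) \<in> ?B"
      using B1[OF range_in_dense_subtriple ghk(2) x] by (simp only: F.product_sym[of x])
    ultimately show ?thesis
      unfolding eq using BG B1[OF ghk(1,2) z]
        B2[OF range_in_dense_subtriple range_in_dense_subtriple y] range_in_dense_subtriple
      by (intro F.subspace_add[OF sub] F.subspace_diff[OF sub]) blast+
  qed
  with sub show ?thesis by (simp add: subtriple_def)
qed

section \<open>Density in \<open>F0\<close> and the conclusions\<close>

lemma F0_in_closure: "F0 \<subseteq> closure dense_subtriple"
  by (rule F.closed_subtriple_generated_least[OF _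
        F.subtriple_closure[OF subtriple_dense_subtriple] closed_closure])
    (use range_in_dense_subtriple closure_subset[of dense_subtriple] in auto)

lemma triple_ideal_separating_space: "triple_ideal sF pF F0 I"
  unfolding triple_ideal_def
proof (intro conjI ballI separating_space_in_F0 subspace_separating_space)
  fix x y i assume x: "x \<in> F0" and y: "y \<in> F0" and i: "i \<in> I"
  have cl: "x \<in> closure dense_subtriple" "y \<in> closure dense_subtriple" "i \<in> closure I"
    using x y i F0_in_closure closure_subset by auto
  show "pF x y i \<in> I"
    by (rule F.product_closure[OF dense_subtriple_ideal(1) closed_separating_space cl])
  show "pF x i y \<in> I"
    by (rule F.product_closure[OF dense_subtriple_ideal(2) closed_separating_space cl(1,3,2)])
qed

text \<open>The two sides of multiplicativity differ by a defect, which lies in the annihilator and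
  hence in \<open>J\<close>.\<close>

lemma triple_homomorphism_quotient:
  assumes J: "triple_ideal sF pF F0 J" and ann: "triple_annihilator pF F0 I \<subseteq> J"
  shows "triple_homomorphism (triple_on sE pE UNIV) (quotient_triple (triple_on sF pF F0) J)
    (triple_coset (triple_on sF pF F0) J \<circ> T)"
proof -
  have "F.subspace J" using J by (simp add: triple_ideal_def)
  then have "triple_coset (triple_on sF pF F0) J (T (pE x y z)) =
      triple_coset (triple_on sF pF F0) J (pF (T x) (T y) (T z))" for x y z
    using F.triple_coset_eq_iff defect_in_triple_annihilator[of x y z] ann
    by (auto simp: triple_defect_def)
  then show ?thesis
    unfolding triple_homomorphism_def
    using F.quotient_triple_operations[OF F0_subtriple J range_in_F0 range_in_F0 range_in_F0]
    by (auto simp: triple_on_def quotient_triple_def T.add T.scale range_in_F0)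
qed

end

theorem proposition3:
  fixes sE :: "'k::conj_scalar \<Rightarrow> 'a::banach \<Rightarrow> 'a"
    and sF :: "'k \<Rightarrow> 'b::banach \<Rightarrow> 'b"
    and pE :: "'a \<Rightarrow> 'a \<Rightarrow> 'a \<Rightarrow> 'a"
    and pF :: "'b \<Rightarrow> 'b \<Rightarrow> 'b \<Rightarrow> 'b"
    and T :: "'a \<Rightarrow> 'b"
    and I F0 :: "'b set"
  assumes "jordan_banach_triple sE pE"
    and "jordan_banach_triple sF pF"
    and "generalised_triple_homomorphism sE pE sF pF T"
    and "I = separating_space T"
    and "F0 = closed_subtriple_generated sF pF (range T)"
  shows "(triple_ideal sF pF F0 I \<and> closed I) \<and>
    (\<forall>a b c. triple_defect pE pF T a b c \<in> triple_annihilator pF F0 I) \<and>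
    (\<forall>J. triple_ideal sF pF F0 J \<and> closed J \<and> triple_annihilator pF F0 I \<subseteq> J \<longrightarrow>
       triple_homomorphism
         (triple_on sE pE UNIV)
         (quotient_triple (triple_on sF pF F0) (J \<inter> F0))
         (triple_coset (triple_on sF pF F0) (J \<inter> F0) \<circ> T))"
proof -
  interpret generalised_triple_hom sE pE sF pF T
    using assms(1-3) by (simp add: generalised_triple_hom_def generalised_triple_hom_axioms_def)
  \<comment> \<open>A triple ideal of \<open>F0\<close> is contained in \<open>F0\<close> by
    definition, so both quotients are the same.\<close>
  have "J \<inter> F0 = J" if "triple_ideal sF pF F0 J" for J
    using that by (auto simp: triple_ideal_def)
  then show ?thesis
    using triple_ideal_separating_space closed_separating_space defect_in_triple_annihilator
      triple_homomorphism_quotient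
    unfolding assms(4,5) by simp
qed

end
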